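(* If $k\in\mathbb{N}$, $\gamma>0$ and $k_1=k+\frac12$, then with $C_0=\sqrt\pi\operatorname{erf}(\frac\pi2)$, $$\frac{C_0}{e\sqrt{8\pi k_1}}\,e^{-2\operatorname{arsinh}\frac{\gamma}{2\sqrt{k_1}}} \;\le\; e^{\frac{\gamma^2}{2}-\gamma\sqrt{k_1+\frac{\gamma^2}{4}}-2k_1\operatorname{arsinh}\frac{\gamma}{2\sqrt{k_1}}}\,L_k^{(0)}(-\gamma^2) \;\le\; \sqrt{\frac{27}{e}}.$$
   Context: $\mathbb{N}=\{0,1,2,\dots\}$; $\operatorname{erf}(z)=\frac{2}{\sqrt\pi}\int_0^z e^{-t^2}\,dt$. The Laguerre polynomials are $L_k^{(0)}(x)=\sum_{m=0}^k\frac{1}{m!}\binom{k}{m}(-x)^m$. *)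

theory Defs
  imports "HOL-Analysis.Analysis"
begin

text \<open>The error function on the real line. The interval integral is oriented, so the
  definition is also the intended one for negative arguments.\<close>

definition erf :: "real \<Rightarrow> real" where
  "erf x = 2 / sqrt pi * (LBINT t=0..x. exp (- t\<^sup>2))"

text \<open>The Laguerre polynomials with parameter 0, as functions on the reals.\<close>

definition laguerre0 :: "nat \<Rightarrow> real \<Rightarrow> real" where
  "laguerre0 k x = (\<Sum>m=0..k. 1 / fact m * real (k choose m) * (- x) ^ m)"

end

theory Submission
  imports Defs
begin

text \<open>With \<open>s = arsinh (\<gamma> / (2 * sqrt k1))\<close>, \<open>q = exp (- 2 * s)\<close>, \<open>p = 1 - q\<close> and \<open>\<mu> = k1 * p\<close> we have
  \<open>\<gamma>\<^sup>2 = k1 * p\<^sup>2 / q\<close>, and the quantity to be estimated equals \<open>sqrt q\<close> times the probability that a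
  binomial variable with parameters \<open>(k, p)\<close> and an independent Poisson variable of mean \<open>\<mu>\<close> coincide.
  The upper bound is therefore trivial, even with 1 on the right. For the lower bound, Jensen's
  inequality is applied to the logarithm of the Poisson weights, which by Stirling's bound is at least
  a quadratic polynomial; its binomial expectation is explicit.\<close>

section \<open>Poisson weights and factorials\<close>

lemma poisson_weight_le_1:
  fixes \<mu> :: real
  assumes "\<mu> \<ge> 0"
  shows "exp (- \<mu>) * \<mu> ^ m / fact m \<le> 1"
proof -
  have "(\<Sum>n\<in>{m}. \<mu> ^ n /\<^sub>R fact n) \<le> exp \<mu>"
    unfolding exp_def by (rule sum_le_suminf) (use assms in \<open>auto intro: summable_exp\<close>)
  then show ?thesis
    by (simp add: exp_minus field_simps)
qed

text \<open>Stirling's upper bound with constant \<open>exp 1\<close>, an equality at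
  \<open>m = 1\<close>. The induction step amounts to
  \<open>(m + 1 / 2) * ln (1 + 1 / m) \<ge> 1\<close>, the midpoint bound for the integral of
  \<open>1 / t\<close> over \<open>[m, m + 1]\<close>.\<close>

lemma ln_fact_le:
  assumes "m \<ge> 1"
  shows "ln (fact m :: real) \<le> 1 + (real m + 1 / 2) * ln (real m) - real m"
  using assms
proof (induction m rule: nat_induct_at_least)
  case base
  then show ?case by simp
next
  case (Suc m)
  have "ln (real m + 1) - ln (real m) \<ge> 2 * (real m + 1 - real m) / (real m + (real m + 1))"
    by (rule ln_inverse_approx_ge) (use Suc in auto)
  then have "(real m + 1 / 2) * (ln (real m + 1) - ln (real m)) \<ge> 1"
    by (simp add: field_simps)
  moreover have "ln (fact (Suc m) :: real) = ln (real m + 1) + ln (fact m)"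
    by (simp add: ln_mult add.commute)
  ultimately show ?case
    using Suc.IH by (simp add: algebra_simps)
qed

lemma ln_le_tangent:
  fixes a x :: real
  assumes "a > 0" "x > 0"
  shows "ln x \<le> ln a + (x - a) / a"
  using ln_le_minus_one[of "x / a"] assms by (simp add: ln_div diff_divide_distrib)

text \<open>The shift by \<open>1 / 2\<close> inside the logarithm keeps the bound valid at \<open>m = 0\<close> for arbitrarily
  small \<open>\<mu>\<close>.\<close>

lemma poisson_weight_ge:
  fixes \<mu> :: real
  assumes "\<mu> > 0"
  shows "exp (- 1 - (real m - \<mu>)\<^sup>2 / \<mu> - ln (\<mu> + 1 / 2) / 2 - (real m - \<mu>) / (2 * \<mu> + 1))
    \<le> exp (- \<mu>) * \<mu> ^ m / fact m"
proof -
  have fact: "ln (fact m :: real) \<le> 1 - 2 * real m + real m * ln \<mu> + (real m)\<^sup>2 / \<mu> + ln (real m + 1 / 2) / 2"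
  proof (cases "m = 0")
    case True
    \<comment> \<open>At \<open>m = 0\<close> the claim is
      \<open>0 \<le> 1 - ln 2 / 2\<close>.\<close>
    have "ln (2::real) \<le> 1"
      using ln_le_minus_one[of 2] by simp
    with True show ?thesis
      by (simp add: ln_div)
  next
    case False
    \<comment> \<open>The tangent at \<open>\<mu>\<close> makes the bound quadratic in
      \<open>m\<close>, apart from \<open>m * ln \<mu>\<close>, which cancels against
      \<open>\<mu> ^ m\<close>.\<close>
    have "real m * ln (real m) \<le> real m * (ln \<mu> + (real m - \<mu>) / \<mu>)"
      using ln_le_tangent[of \<mu> "real m"] assms False by (intro mult_left_mono) auto
    also have "\<dots> = real m * ln \<mu> + (real m)\<^sup>2 / \<mu> - real m"
      using assms by (simp add: field_simps power2_eq_square)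
    finally have "real m * ln (real m) \<le> real m * ln \<mu> + (real m)\<^sup>2 / \<mu> - real m" .
    moreover have "ln (real m) \<le> ln (real m + 1 / 2)"
      using False by simp
    moreover have "ln (fact m :: real) \<le> 1 + real m * ln (real m) + ln (real m) / 2 - real m"
      using ln_fact_le[of m] False by (simp add: algebra_simps)
    ultimately show ?thesis
      by linarith
  qed
  \<comment> \<open>The remaining logarithm becomes affine in \<open>m\<close>, so that only
    binomial moments up to order two will occur.\<close>
  have "ln (real m + 1 / 2) \<le> ln (\<mu> + 1 / 2) + (real m - \<mu>) / (\<mu> + 1 / 2)"
    using ln_le_tangent[of "\<mu> + 1 / 2" "real m + 1 / 2"] assms by simp
  also have "(real m - \<mu>) / (\<mu> + 1 / 2) = 2 * ((real m - \<mu>) / (2 * \<mu> + 1))"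
    using assms by (simp add: field_simps)
  finally have tangent: "ln (real m + 1 / 2) / 2 \<le> ln (\<mu> + 1 / 2) / 2 + (real m - \<mu>) / (2 * \<mu> + 1)"
    by linarith
  have square: "(real m - \<mu>)\<^sup>2 / \<mu> = (real m)\<^sup>2 / \<mu> - 2 * real m + \<mu>"
    using assms by (simp add: field_simps power2_eq_square)
  have "- 1 - (real m - \<mu>)\<^sup>2 / \<mu> - ln (\<mu> + 1 / 2) / 2 - (real m - \<mu>) / (2 * \<mu> + 1)
      \<le> - \<mu> + real m * ln \<mu> - ln (fact m)"
    using fact tangent square by linarith
  also have "\<dots> = ln (exp (- \<mu>) * \<mu> ^ m / fact m)"
    using assms by (simp add: ln_mult ln_div ln_realpow)
  finally show ?thesis
    using assms by (subst (asm) ln_ge_iff) auto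
qed

section \<open>Jensen's inequality and binomial averages\<close>

text \<open>Averages the tangent bound for \<open>exp\<close> at the mean \<open>G\<close>; the
  linear term averages to zero.\<close>

lemma exp_jensen_sum:
  fixes w g :: "'a \<Rightarrow> real"
  assumes "\<And>i. i \<in> A \<Longrightarrow> w i \<ge> 0" "(\<Sum>i\<in>A. w i) = 1"
  shows "exp (\<Sum>i\<in>A. w i * g i) \<le> (\<Sum>i\<in>A. w i * exp (g i))"
proof -
  define G where "G = (\<Sum>i\<in>A. w i * g i)"
  have "exp G * (1 + (g i - G)) \<le> exp (g i)" for i
    using mult_left_mono[OF exp_ge_add_one_self[of "g i - G"], of "exp G"]
    by (simp add: exp_add[symmetric])
  then have "(\<Sum>i\<in>A. w i * (exp G * (1 + (g i - G)))) \<le> (\<Sum>i\<in>A. w i * exp (g i))"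
    using assms(1) by (intro sum_mono mult_left_mono) auto
  moreover have "(\<Sum>i\<in>A. w i * (exp G * (1 + (g i - G))))
      = exp G * ((1 - G) * (\<Sum>i\<in>A. w i) + (\<Sum>i\<in>A. w i * g i))"
    unfolding sum_distrib_left sum.distrib[symmetric] by (intro sum.cong) (auto simp: algebra_simps)
  ultimately show ?thesis
    using assms(2) by (simp add: G_def)
qed

text \<open>Variance plus squared bias. The centre \<open>c\<close> is free because the Poisson mean
  \<open>N * p\<close> exceeds the binomial mean \<open>k * p\<close> by
  \<open>p / 2\<close>.\<close>

lemma sum_Bernstein_square_diff:
  "(\<Sum>m\<le>k. Bernstein k m p * (real m - c)\<^sup>2) = real k * p * (1 - p) + (real k * p - c)\<^sup>2"
proof -
  have "(\<Sum>m\<le>k. Bernstein k m p * (real m - c)\<^sup>2) =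
     (\<Sum>m\<le>k. real m * (real m - 1) * Bernstein k m p + (1 - 2 * c) * (real m * Bernstein k m p)
       + c\<^sup>2 * Bernstein k m p)"
    by (intro sum.cong) (auto simp: algebra_simps power2_eq_square)
  also have "\<dots> = real k * (real k - 1) * p\<^sup>2 + (1 - 2 * c) * (real k * p) + c\<^sup>2"
    by (simp add: sum.distrib sum_distrib_left[symmetric])
  finally show ?thesis
    by (simp add: algebra_simps power2_eq_square)
qed

lemma binomial_poisson_coincidence_ge:
  fixes p N \<mu> :: real
  assumes p: "0 < p" "p < 1" and N: "N = real k + 1 / 2" and \<mu>: "\<mu> = N * p"
  shows "sqrt ((1 - p) / (2 * N)) / exp 1 \<le> (\<Sum>m\<le>k. Bernstein k m p * (exp (- \<mu>) * \<mu> ^ m / fact m))"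
proof -
  \<comment> \<open>Since \<open>k = (1 - u) * N\<close>, the final estimate depends only on
    \<open>p\<close> and \<open>u\<close> in the unit square; \<open>u = 1\<close> is the case
    \<open>k = 0\<close>.\<close>
  define u where "u = 1 / (2 * N)"
  have Npos: "N > 0" and u: "0 < u" "u \<le> 1"
    using N by (auto simp: u_def)
  have \<mu>pos: "\<mu> > 0"
    using Npos p by (simp add: \<mu>)
  define c where "c = - 1 - ln (\<mu> + 1 / 2) / 2"
  define g where "g m = c - (real m - \<mu>)\<^sup>2 / \<mu> - (real m - \<mu>) / (2 * \<mu> + 1)" for m :: nat
  define G where "G = (\<Sum>m\<le>k. Bernstein k m p * g m)"
  have "real k * p = (1 - u) * \<mu>"
    using Npos unfolding \<mu> u_def by (simp add: field_simps N)
  moreover have "(real k * p - \<mu>)\<^sup>2 = p * u / 2 * \<mu>"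
    using Npos unfolding \<mu> u_def by (simp add: N field_simps power2_eq_square)
  ultimately have quad: "(real k * p * (1 - p) + (real k * p - \<mu>)\<^sup>2) / \<mu> = (1 - u) * (1 - p) + p * u / 2"
    using \<mu>pos by (simp add: add_divide_distrib)
  have "G = (\<Sum>m\<le>k. (c + \<mu> / (2 * \<mu> + 1)) * Bernstein k m p
       - (1 / \<mu>) * (Bernstein k m p * (real m - \<mu>)\<^sup>2)
       - (1 / (2 * \<mu> + 1)) * (real m * Bernstein k m p))"
    unfolding G_def g_def
    by (intro sum.cong) (simp_all add: diff_divide_distrib algebra_simps)
  also have "\<dots> = c + \<mu> / (2 * \<mu> + 1) - (real k * p * (1 - p) + (real k * p - \<mu>)\<^sup>2) / \<mu>
       - real k * p / (2 * \<mu> + 1)"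
    unfolding sum_subtractf sum_distrib_left[symmetric] sum_Bernstein_square_diff sum_k_Bernstein sum_Bernstein
    by simp
  also have "\<dots> = c + (\<mu> - real k * p) / (2 * \<mu> + 1) - (1 - u) * (1 - p) - p * u / 2"
    unfolding quad by (simp add: diff_divide_distrib)
  \<comment> \<open>The dropped fraction has the positive numerator \<open>p / 2\<close>.\<close>
  also have "\<dots> \<ge> c - (1 - u) * (1 - p) - p * u / 2"
    using \<mu>pos p by (simp add: \<mu> N algebra_simps)
  finally have G: "G \<ge> c - (1 - u) * (1 - p) - p * u / 2" .

  \<comment> \<open>This is \<open>(1 - p) * u * (\<mu> + 1 / 2)\<close>: it joins the logarithm in
    \<open>c\<close> with that of the target, leaving
    \<open>ln y + 2 * (1 - u) * (1 - p) + p * u \<le> 0\<close> to show.\<close>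
  define y where "y = (1 - p) * (p + u) / 2"
  have ypos: "y > 0"
    using p u by (simp add: y_def)
  \<comment> \<open>The tangent of \<open>ln\<close> at \<open>1 / exp 1\<close>; replacing
    \<open>exp 1\<close> by 3 then reduces the claim to a polynomial inequality.\<close>
  have "ln (exp 1 * y) \<le> exp 1 * y - 1"
    using ypos by (intro ln_le_minus_one) simp
  then have "ln y \<le> exp 1 * y - 2"
    using ypos by (simp add: ln_mult)
  also have "exp 1 * y \<le> 3 * y"
    using ypos exp_le by (intro mult_right_mono) auto
  finally have lny: "ln y \<le> 3 * y - 2"
    by simp
  \<comment> \<open>The left side is affine in \<open>u\<close>, hence interpolates between its
    values at \<open>u = 0\<close> and \<open>u = 1\<close>, both nonnegative.\<close>
  have "2 - (2 * (1 - u) * (1 - p) + p * u + 3 * y) = (1 - u) * (p * (1 + 3 * p) / 2)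
      + u * ((1 / 2 - p + 3 * p\<^sup>2 / 2))"
    by (simp add: y_def field_simps power2_eq_square)
  moreover have "1 / 2 - p + 3 * p\<^sup>2 / 2 = (3 * p - 1)\<^sup>2 / 6 + 1 / 3"
    by (simp add: field_simps power2_eq_square)
  then have "1 / 2 - p + 3 * p\<^sup>2 / 2 \<ge> 0"
    by simp
  ultimately have "2 * (1 - u) * (1 - p) + p * u + 3 * y \<le> 2"
    using p u
    by (smt (verit) mult_nonneg_nonneg divide_nonneg_nonneg)
  with lny have final: "ln y + 2 * (1 - u) * (1 - p) + p * u \<le> 0"
    by linarith
  have "y = ((1 - p) * u) * (\<mu> + 1 / 2)"
    using Npos by (simp add: y_def u_def \<mu> field_simps)
  then have "ln y = ln ((1 - p) * u) + ln (\<mu> + 1 / 2)"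
    using p u \<mu>pos by (simp add: ln_mult)
  with final have "ln ((1 - p) * u) / 2 - 1 \<le> c - (1 - u) * (1 - p) - p * u / 2"
    by (simp add: c_def algebra_simps)
  with G have "ln ((1 - p) * u) / 2 - 1 \<le> G"
    by linarith
  then have "exp (ln ((1 - p) * u) / 2) / exp 1 \<le> exp G"
    by (simp flip: exp_diff)
  also have "exp (ln ((1 - p) * u) / 2) = sqrt ((1 - p) / (2 * N))"
    using p u by (simp add: u_def ln_sqrt[symmetric])
  also have "exp G \<le> (\<Sum>m\<le>k. Bernstein k m p * exp (g m))"
    unfolding G_def by (rule exp_jensen_sum) (use p in \<open>auto intro: Bernstein_nonneg\<close>)
  also have "\<dots> \<le> (\<Sum>m\<le>k. Bernstein k m p * (exp (- \<mu>) * \<mu> ^ m / fact m))"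
    using poisson_weight_ge[OF \<mu>pos] p
    by (intro sum_mono mult_left_mono Bernstein_nonneg) (auto simp: g_def c_def algebra_simps)
  finally show ?thesis .
qed

section \<open>Error function and Laguerre polynomial\<close>

lemma erf_le:
  assumes "x \<ge> 0"
  shows "erf x \<le> 2 / sqrt pi * x"
proof -
  have "(LBINT t=0..x. exp (- t\<^sup>2)) = integral {0..x} (\<lambda>t. exp (- t\<^sup>2))"
    unfolding zero_ereal_def using assms
    by (intro interval_integral_eq_integral borel_integrable_atLeastAtMost') (auto intro!: continuous_intros)
  also have "\<dots> \<le> integral {0..x} (\<lambda>t. 1)"
    by (intro integral_le integrable_continuous_interval) (auto intro!: continuous_intros)
  also have "\<dots> = x"
    using assms by simp
  finally show ?thesis
    unfolding erf_def by (intro mult_left_mono) auto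
qed

text \<open>The sums agree term by term: \<open>\<gamma>\<^sup>2 = p * \<mu> / q\<close> with
  \<open>q = exp (- 2 * s)\<close>, and the exponential prefactor is
  \<open>exp (- s) * q ^ k * exp (- \<mu>)\<close>.\<close>

lemma laguerre0_binomial_poisson:
  fixes N \<gamma> s p \<mu> :: real
  assumes "N = real k + 1 / 2" "s = arsinh (\<gamma> / (2 * sqrt N))"
    and p: "p = 1 - exp (- 2 * s)" and \<mu>: "\<mu> = N * p"
  shows "exp (\<gamma>\<^sup>2 / 2 - \<gamma> * sqrt (N + \<gamma>\<^sup>2 / 4) - 2 * N * s) * laguerre0 k (- \<gamma>\<^sup>2)
    = exp (- s) * (\<Sum>m\<le>k. Bernstein k m p * (exp (- \<mu>) * \<mu> ^ m / fact m))"
proof -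
  define q where "q = exp (- 2 * s)"
  have N: "N > 0"
    using assms by simp
  have q: "q > 0" "p = 1 - q"
    by (auto simp: q_def p)
  have \<gamma>: "\<gamma> = 2 * sqrt N * sinh s"
    using N by (simp add: assms(2))
  have e1: "exp s * exp s = 1 / q" and e2: "exp (- s) * exp (- s) = q" and e3: "exp s * exp (- s) = 1"
    unfolding q_def by (simp_all flip: exp_add exp_minus inverse_eq_divide)
  have "4 * (sinh s)\<^sup>2 = exp s * exp s - 2 * (exp s * exp (- s)) + exp (- s) * exp (- s)"
    by (simp add: sinh_field_def power2_eq_square field_simps)
  then have sinh2: "4 * (sinh s)\<^sup>2 = 1 / q - 2 + q"
    unfolding e1 e2 e3 by simp
  have "4 * (sinh s * cosh s) = exp s * exp s - exp (- s) * exp (- s)"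
    by (simp add: sinh_field_def cosh_field_def field_simps)
  then have shch: "4 * (sinh s * cosh s) = 1 / q - q"
    unfolding e1 e2 .
  have \<gamma>2: "\<gamma>\<^sup>2 = N * (1 / q - 2 + q)"
    using N unfolding sinh2[symmetric] by (simp add: \<gamma> power_mult_distrib)
  \<comment> \<open>A perfect square up to the factor \<open>N\<close>, so the root turns into
    \<open>sqrt N * cosh s\<close>.\<close>
  have "N + \<gamma>\<^sup>2 / 4 = N * (cosh s)\<^sup>2"
    using N by (simp add: \<gamma> power_mult_distrib cosh_square_eq algebra_simps)
  then have "\<gamma> * sqrt (N + \<gamma>\<^sup>2 / 4) = 2 * (sqrt N * sqrt N) * (sinh s * cosh s)"
    by (simp add: \<gamma> real_sqrt_mult)
  also have "\<dots> = N * (1 / q - q) / 2"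
    using N by (simp flip: shch)
  \<comment> \<open>The \<open>1 / q\<close> terms cancel, leaving
    \<open>N * (q - 1) = - \<mu>\<close>; the half in \<open>N\<close> produces the separate
    \<open>- s\<close>.\<close>
  finally have "\<gamma>\<^sup>2 / 2 - \<gamma> * sqrt (N + \<gamma>\<^sup>2 / 4) - 2 * N * s = - s + real k * (- 2 * s) - \<mu>"
    unfolding \<gamma>2 \<mu> q assms(1) using q(1) by (simp add: field_simps)
  then have E: "exp (\<gamma>\<^sup>2 / 2 - \<gamma> * sqrt (N + \<gamma>\<^sup>2 / 4) - 2 * N * s) = exp (- s) * (q ^ k * exp (- \<mu>))"
    unfolding q_def exp_of_nat_mult[symmetric] by (simp flip: exp_add)
  have x: "\<gamma>\<^sup>2 = p * \<mu> / q"
    unfolding \<gamma>2 \<mu> q using q(1) by (simp add: field_simps power2_eq_square)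
  have "q ^ k * exp (- \<mu>) * laguerre0 k (- \<gamma>\<^sup>2)
      = (\<Sum>m\<le>k. Bernstein k m p * (exp (- \<mu>) * \<mu> ^ m / fact m))"
    unfolding laguerre0_def sum_distrib_left atMost_atLeast0
  proof (intro sum.cong refl)
    fix m
    assume "m \<in> {0..k}"
    \<comment> \<open>One factor enters the Bernstein polynomial, the other clears the denominator
      of \<open>(p * \<mu> / q) ^ m\<close>.\<close>
    then have "q ^ k = q ^ (k - m) * q ^ m"
      by (simp flip: power_add)
    then show "q ^ k * exp (- \<mu>) * (1 / fact m * real (k choose m) * (- (- \<gamma>\<^sup>2)) ^ m)
        = Bernstein k m p * (exp (- \<mu>) * \<mu> ^ m / fact m)"
      using q(1) by (simp add: Bernstein_def x q(2) power_mult_distrib power_divide)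
  qed
  with E show ?thesis
    by (simp add: mult.assoc)
qed

section \<open>Assembly of the two bounds\<close>

theorem corollary6p4:
  fixes k :: nat and \<gamma> k1 C0 :: real
  assumes "\<gamma> > 0"
    and "k1 = real k + 1 / 2"
    and "C0 = sqrt pi * erf (pi / 2)"
  shows "C0 / (exp 1 * sqrt (8 * pi * k1)) * exp (- 2 * arsinh (\<gamma> / (2 * sqrt k1)))
      \<le> exp (\<gamma>\<^sup>2 / 2 - \<gamma> * sqrt (k1 + \<gamma>\<^sup>2 / 4) - 2 * k1 * arsinh (\<gamma> / (2 * sqrt k1)))
          * laguerre0 k (- \<gamma>\<^sup>2)
    \<and> exp (\<gamma>\<^sup>2 / 2 - \<gamma> * sqrt (k1 + \<gamma>\<^sup>2 / 4) - 2 * k1 * arsinh (\<gamma> / (2 * sqrt k1)))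
          * laguerre0 k (- \<gamma>\<^sup>2)
      \<le> sqrt (27 / exp 1)"
proof -
  define s where "s = arsinh (\<gamma> / (2 * sqrt k1))"
  define p where "p = 1 - exp (- 2 * s)"
  define \<mu> where "\<mu> = k1 * p"
  define S where "S = (\<Sum>m\<le>k. Bernstein k m p * (exp (- \<mu>) * \<mu> ^ m / fact m))"
  have k1: "k1 > 0"
    using assms(2) by simp
  have s: "s > 0"
    using assms(1) k1 by (simp add: s_def)
  have p: "0 < p" "p < 1"
    using s by (auto simp: p_def)
  have mid: "exp (\<gamma>\<^sup>2 / 2 - \<gamma> * sqrt (k1 + \<gamma>\<^sup>2 / 4) - 2 * k1 * s) * laguerre0 k (- \<gamma>\<^sup>2) = exp (- s) * S"
    unfolding S_def by (rule laguerre0_binomial_poisson[OF assms(2) s_def p_def \<mu>_def])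

  have "S \<le> (\<Sum>m\<le>k. Bernstein k m p * 1)"
    unfolding S_def using p k1
    by (intro sum_mono mult_left_mono poisson_weight_le_1 Bernstein_nonneg) (auto simp: \<mu>_def)
  then have "S \<le> 1"
    by simp
  then have "exp (- s) * S \<le> exp (- s) * 1"
    by (intro mult_left_mono) auto
  also have "\<dots> \<le> 1"
    using s by simp
  also have "1 \<le> sqrt (27 / exp 1)"
    using exp_le by simp
  finally have upper: "exp (- s) * S \<le> sqrt (27 / exp 1)" .

  have es: "exp (- s) = sqrt (1 - p)"
    by (intro real_sqrt_unique[symmetric]) (auto simp: p_def power2_eq_square simp flip: exp_add)
  \<comment> \<open>Bounding the integrand of \<open>erf\<close> by 1 gives
    \<open>C0 \<le> pi\<close>; the comparison of constants then comes down to
    \<open>pi \<le> 4\<close>.\<close>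
  have "C0 \<le> sqrt pi * (2 / sqrt pi * (pi / 2))"
    unfolding assms(3) by (intro mult_left_mono erf_le) auto
  also have "\<dots> = pi"
    by simp
  finally have "C0 / (exp 1 * sqrt (8 * pi * k1)) \<le> pi / (exp 1 * sqrt (8 * pi * k1))"
    using k1 by (intro divide_right_mono) auto
  also have "pi / (exp 1 * sqrt (8 * pi * k1)) = sqrt (pi\<^sup>2 / (8 * pi * k1)) / exp 1"
    by (simp add: real_sqrt_divide)
  also have "pi\<^sup>2 / (8 * pi * k1) = pi / (8 * k1)"
    by (simp add: power2_eq_square)
  also have "sqrt (pi / (8 * k1)) / exp 1 \<le> sqrt (1 / (2 * k1)) / exp 1"
    using k1 pi_less_4 by (intro divide_right_mono real_sqrt_le_mono) (auto simp: field_simps)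
  finally have "C0 / (exp 1 * sqrt (8 * pi * k1)) * exp (- s) \<le> sqrt (1 / (2 * k1)) / exp 1 * exp (- s)"
    by (intro mult_right_mono) auto
  also have "sqrt (1 / (2 * k1)) / exp 1 * exp (- s) = sqrt ((1 - p) / (2 * k1)) / exp 1"
    by (simp add: es real_sqrt_divide)
  also have "\<dots> \<le> S"
    unfolding S_def by (rule binomial_poisson_coincidence_ge[OF p assms(2) \<mu>_def])
  \<comment> \<open>Of the two factors \<open>exp (- s)\<close> on the left, one is the prefactor of
    \<open>S\<close>, the other the \<open>sqrt (1 - p)\<close> from the lower bound on
    \<open>S\<close>.\<close>
  finally have "exp (- s) * (C0 / (exp 1 * sqrt (8 * pi * k1)) * exp (- s)) \<le> exp (- s) * S"
    by (intro mult_left_mono) auto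
  moreover have "exp (- 2 * s) = exp (- s) * exp (- s)"
    by (simp flip: exp_add)
  ultimately have lower: "C0 / (exp 1 * sqrt (8 * pi * k1)) * exp (- 2 * s) \<le> exp (- s) * S"
    by (simp add: mult_ac)
  show ?thesis
    using lower upper unfolding s_def[symmetric] mid by blast
qed

end
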